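(* Let $L$ be a finite-dimensional (right) Leibniz algebra over an algebraically closed field $F$ of characteristic zero, and assume $L$ is a Killing Leibniz algebra, i.e. for all $x,y\in L$ the trace of the restriction $(ad_x\circ ad_y)_{|\mathrm{Ess}(L)}$ is zero. Let $\ker(\mathfrak{K})=\{x\in L:\ \mathrm{tr}(ad_x\circ ad_y)=0 \text{ for all } y\in L\}$ be the kernel of the Killing form of $L$. Then $\ker(\mathfrak{K})=\mathrm{Ess}(L)$ if and only if $L$ is semisimple.
   Context: A (right) Leibniz algebra is a vector space $L$ with a bilinear bracket satisfying $[x,[y,z]]=[[x,y],z]-[[x,z],y]$ for all $x,y,z\in L$. For $x\in L$, $ad_x:L\to L$ is $ad_x(y)=[y,x]$. The Killing form is $\mathfrak{K}(x,y)=\mathrm{tr}(ad_x\circ ad_y)$. $\mathrm{Ess}(L)$ denotes the linear span of all squares $[x,x]$, $x\in L$; it is a two-sided ideal, hence invariant under each $ad_x\circ ad_y$. For subspaces $X,Y$, $[X,Y]$ is the span of all $[u,v]$, $u\in X,v\in Y$. The derived series is $D^1(L)=[L,L]$, $D^{n+1}(L)=[D^n(L),D^n(L)]$; $L$ is solvable if $D^m(L)=0$ for some $m\ge1$. $\mathrm{Rad}(L)$ is the largest solvable (two-sided) ideal of $L$. $L$ is called semisimple if $\mathrm{Rad}(L)=\mathrm{Ess}(L)$. *)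

theory Defs
  imports Main "HOL-Computational_Algebra.Polynomial"
begin

definition alg_closed :: "'k::field itself \<Rightarrow> bool" where
  "alg_closed _ \<longleftrightarrow> (\<forall>p :: 'k poly. degree p > 0 \<longrightarrow> (\<exists>z. poly p z = 0))"

text \<open>Trace of a linear map f restricted to a (finite-dimensional, f-invariant)
  subspace W, computed with respect to a chosen basis of W.\<close>
definition trace_on :: "('k::field \<Rightarrow> 'a::ab_group_add \<Rightarrow> 'a) \<Rightarrow> 'a set \<Rightarrow> ('a \<Rightarrow> 'a) \<Rightarrow> 'k" where
  "trace_on s W f =
    (let B = (SOME B. B \<subseteq> W \<and> \<not> module.dependent s B \<and> module.span s B = W)
     in \<Sum>b\<in>B. module.representation s B (f b) b)"

definition leibniz_algebra :: "('k::field \<Rightarrow> 'a::ab_group_add \<Rightarrow> 'a) \<Rightarrow> ('a \<Rightarrow> 'a \<Rightarrow> 'a) \<Rightarrow> bool" where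
  "leibniz_algebra s br \<longleftrightarrow>
     (\<forall>x. Vector_Spaces.linear s s (br x)) \<and>
     (\<forall>y. Vector_Spaces.linear s s (\<lambda>x. br x y)) \<and>
     (\<forall>x y z. br x (br y z) = br (br x y) z - br (br x z) y)"

definition ad :: "('a \<Rightarrow> 'a \<Rightarrow> 'a) \<Rightarrow> 'a \<Rightarrow> 'a \<Rightarrow> 'a" where
  "ad br x = (\<lambda>y. br y x)"

definition Ess :: "('k::field \<Rightarrow> 'a::ab_group_add \<Rightarrow> 'a) \<Rightarrow> ('a \<Rightarrow> 'a \<Rightarrow> 'a) \<Rightarrow> 'a set" where
  "Ess s br = module.span s {br x x | x. True}"

definition brk :: "('k::field \<Rightarrow> 'a::ab_group_add \<Rightarrow> 'a) \<Rightarrow> ('a \<Rightarrow> 'a \<Rightarrow> 'a) \<Rightarrow> 'a set \<Rightarrow> 'a set \<Rightarrow> 'a set" where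
  "brk s br X Y = module.span s {br u v | u v. u \<in> X \<and> v \<in> Y}"

definition lideal :: "('k::field \<Rightarrow> 'a::ab_group_add \<Rightarrow> 'a) \<Rightarrow> ('a \<Rightarrow> 'a \<Rightarrow> 'a) \<Rightarrow> 'a set \<Rightarrow> bool" where
  "lideal s br I \<longleftrightarrow> module.subspace s I \<and> (\<forall>x\<in>I. \<forall>y. br x y \<in> I \<and> br y x \<in> I)"

fun derived :: "('k::field \<Rightarrow> 'a::ab_group_add \<Rightarrow> 'a) \<Rightarrow> ('a \<Rightarrow> 'a \<Rightarrow> 'a) \<Rightarrow> 'a set \<Rightarrow> nat \<Rightarrow> 'a set" where
  "derived s br I 0 = I"
| "derived s br I (Suc n) = brk s br (derived s br I n) (derived s br I n)"

definition solvable_set :: "('k::field \<Rightarrow> 'a::ab_group_add \<Rightarrow> 'a) \<Rightarrow> ('a \<Rightarrow> 'a \<Rightarrow> 'a) \<Rightarrow> 'a set \<Rightarrow> bool" where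
  "solvable_set s br I \<longleftrightarrow> (\<exists>m\<ge>1. derived s br I m = {0})"

definition Rad :: "('k::field \<Rightarrow> 'a::ab_group_add \<Rightarrow> 'a) \<Rightarrow> ('a \<Rightarrow> 'a \<Rightarrow> 'a) \<Rightarrow> 'a set" where
  "Rad s br = (THE R. lideal s br R \<and> solvable_set s br R \<and>
      (\<forall>I. lideal s br I \<and> solvable_set s br I \<longrightarrow> I \<subseteq> R))"

definition semisimple :: "('k::field \<Rightarrow> 'a::ab_group_add \<Rightarrow> 'a) \<Rightarrow> ('a \<Rightarrow> 'a \<Rightarrow> 'a) \<Rightarrow> bool" where
  "semisimple s br \<longleftrightarrow> Rad s br = Ess s br"

definition killing :: "('k::field \<Rightarrow> 'a::ab_group_add \<Rightarrow> 'a) \<Rightarrow> ('a \<Rightarrow> 'a \<Rightarrow> 'a) \<Rightarrow> 'a \<Rightarrow> 'a \<Rightarrow> 'k" where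
  "killing s br x y = trace_on s UNIV (ad br x \<circ> ad br y)"

definition killing_leibniz :: "('k::field \<Rightarrow> 'a::ab_group_add \<Rightarrow> 'a) \<Rightarrow> ('a \<Rightarrow> 'a \<Rightarrow> 'a) \<Rightarrow> bool" where
  "killing_leibniz s br \<longleftrightarrow> (\<forall>x y. trace_on s (Ess s br) (ad br x \<circ> ad br y) = 0)"

definition ker_killing :: "('k::field \<Rightarrow> 'a::ab_group_add \<Rightarrow> 'a) \<Rightarrow> ('a \<Rightarrow> 'a \<Rightarrow> 'a) \<Rightarrow> 'a set" where
  "ker_killing s br = {x. \<forall>y. killing s br x y = 0}"

end

theory Submission
  imports Defs
begin

text \<open>
  Right multiplications \<open>R\<^sub>x = ad x\<close> are derivations, and \<open>R\<^sub>e = 0\<close> for \<open>e \<in> Ess L\<close>, so \<open>Ess L\<close> is an abelian ideal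
  contained in the kernel of the Killing form.

  If that kernel is \<open>Ess L\<close> and \<open>A\<close> is an ideal with \<open>[A,A] \<subseteq> Ess L\<close>, then for \<open>a \<in> A\<close> the map
  \<open>R\<^sub>a R\<^sub>y\<close> sends \<open>L\<close> into \<open>A\<close> and \<open>A\<close> into \<open>Ess L\<close>, so its trace equals its trace on \<open>Ess L\<close>, which
  vanishes for a Killing algebra; hence \<open>A \<subseteq> Ess L\<close>. Climbing up the derived series, every solvable ideal lies
  in \<open>Ess L\<close>.

  Conversely the kernel \<open>N\<close> of the Killing form is a solvable ideal (Cartan's criterion). For
  \<open>x \<in> [N,N]\<close> and a \<open>\<rat>\<close>-linear \<open>f\<close> from the field to \<open>\<rat>\<close>, let \<open>D\<close> be multiplication by \<open>f(a)\<close> on the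
  generalised \<open>a\<close>-eigenspace of \<open>R\<^sub>x\<close>. Since \<open>R\<^sub>x\<close> is a derivation, so is \<open>D\<close>, and writing \<open>x\<close> as a sum
  of brackets \<open>[u,v]\<close> gives \<open>tr (R\<^sub>x D) = - \<Sum> K(v, D u) = 0\<close>. Applying \<open>f\<close> to this sum of \<open>a f(a)\<close> over the
  eigenvalues gives \<open>\<Sum> f(a)\<^sup>2 = 0\<close>. So all eigenvalues vanish, \<open>R\<^sub>x\<close> is nilpotent, and Engel's
  theorem makes \<open>[N,N]\<close> solvable.
\<close>

text \<open>The union of the kernels of all powers of \<open>X - a\<close>. In this form rule
  induction replaces bookkeeping of the exponent.\<close>

inductive gen_eigen :: "('k::field \<Rightarrow> 'v::ab_group_add \<Rightarrow> 'v) \<Rightarrow> ('v \<Rightarrow> 'v) \<Rightarrow> 'k \<Rightarrow> 'v \<Rightarrow> bool"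
  for s X a where
  zero: "gen_eigen s X a 0"
| step: "gen_eigen s X a (X v - s a v) \<Longrightarrow> gen_eigen s X a v"

text \<open>Horner evaluation of \<open>p(X)\<close> at the vector \<open>v\<close>.\<close>

definition poly_apply :: "('k::field \<Rightarrow> 'v::ab_group_add \<Rightarrow> 'v) \<Rightarrow> ('v \<Rightarrow> 'v) \<Rightarrow> 'k poly \<Rightarrow> 'v \<Rightarrow> 'v" where
  "poly_apply s X p v = fold_coeffs (\<lambda>c w. s c v + X w) p 0"

subsection \<open>Traces of endomorphisms\<close>

context finite_dimensional_vector_space
begin

interpretation E: finite_dimensional_vector_space_pair scale Basis scale Basis
  by unfold_locales

abbreviation endo :: "('b \<Rightarrow> 'b) \<Rightarrow> bool" where
  "endo \<equiv> Vector_Spaces.linear scale scale"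

lemmas endo_add = E.linear_add
  and endo_scale = E.linear_scale
  and endo_sum = E.linear_sum
  and endo_diff = E.linear_diff
  and endo_0 = E.linear_0
  and endo_compose_add = E.linear_compose_add
  and endo_compose_sub = E.linear_compose_sub
  and endo_comp = Vector_Spaces.linear_compose[where ?s1.0 = scale and ?s2.0 = scale and ?s3.0 = scale]

lemma endoI:
  assumes "\<And>x y. f (x + y) = f x + f y" "\<And>c x. f (c *s x) = c *s f x"
  shows "endo f"
  using assms by unfold_locales auto

lemma endo_funpow: "endo f \<Longrightarrow> endo (f ^^ n)"
  by (induction n) (auto intro: linear_id endo_comp)

lemma subspace_vimage_endo: "endo f \<Longrightarrow> subspace W \<Longrightarrow> subspace {x. f x \<in> W}"
  by (auto simp: subspace_def endo_add endo_scale endo_0)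

lemma subspace_image_endo: "endo f \<Longrightarrow> subspace W \<Longrightarrow> subspace (f ` W)"
  by (rule E.linear_subspace_image)

lemma representation_sum_scale:
  assumes "independent B" "\<And>i. i \<in> I \<Longrightarrow> v i \<in> span B"
  shows "representation B (\<Sum>i\<in>I. a i *s v i) b = (\<Sum>i\<in>I. a i * representation B (v i) b)"
  using assms by (subst representation_sum) (auto simp: representation_scale span_scale)

lemma representation_expansion:
  assumes "independent B" "v \<in> span B"
  shows "(\<Sum>b\<in>B. representation B v b *s b) = v"
  using assms by (intro sum_representation_eq) (auto simp: finiteI_independent)

text \<open>Conjugation invariance without matrices: expand \<open>f c\<close> in \<open>B\<close>,
  exchange the sums, and reassemble \<open>b\<close> from its coordinates in
  \<open>C\<close>.\<close>

lemma trace_basis_independent: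
  assumes f: "endo f" and B: "independent B" and C: "independent C"
    and BC: "span B = span C" and inv: "f ` span B \<subseteq> span B"
  shows "(\<Sum>b\<in>B. representation B (f b) b) = (\<Sum>c\<in>C. representation C (f c) c)"
proof -
  have fspan: "f v \<in> span B" "f v \<in> span C" if "v \<in> span B" for v
    using inv BC that by auto
  have mem: "b \<in> span C" if "b \<in> B" for b
    using BC span_base that by auto
  have mem': "c \<in> span B" if "c \<in> C" for c
    using BC span_base that by auto
  have "(\<Sum>c\<in>C. representation C (f c) c)
      = (\<Sum>c\<in>C. representation C (\<Sum>b\<in>B. representation B (f c) b *s b) c)"
    by (intro sum.cong refl) (simp add: representation_expansion B fspan mem')
  also have "\<dots> = (\<Sum>c\<in>C. \<Sum>b\<in>B. representation B (f c) b * representation C b c)"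
    by (intro sum.cong refl representation_sum_scale C mem)
  also have "\<dots> = (\<Sum>b\<in>B. \<Sum>c\<in>C. representation C b c * representation B (f c) b)"
    by (subst sum.swap) (simp add: mult.commute)
  also have "\<dots> = (\<Sum>b\<in>B. representation B (\<Sum>c\<in>C. representation C b c *s f c) b)"
    by (intro sum.cong refl representation_sum_scale[symmetric] B fspan mem')
  also have "\<dots> = (\<Sum>b\<in>B. representation B (f (\<Sum>c\<in>C. representation C b c *s c)) b)"
    using f by (simp add: endo_sum endo_scale)
  also have "\<dots> = (\<Sum>b\<in>B. representation B (f b) b)"
    by (intro sum.cong refl) (simp add: representation_expansion C mem)
  finally show ?thesis by simp
qed

text \<open>Frees \<open>trace_on\<close> from the basis that \<open>SOME\<close> picks.\<close>

lemma trace_on_eq_sum: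
  assumes f: "endo f" and B: "independent B" "span B = W" and inv: "f ` W \<subseteq> W"
  shows "trace_on scale W f = (\<Sum>b\<in>B. representation B (f b) b)"
proof -
  define C where "C = (SOME C. C \<subseteq> W \<and> independent C \<and> span C = W)"
  have "\<exists>C. C \<subseteq> W \<and> independent C \<and> span C = W"
    using B span_superset by (intro exI[of _ B]) auto
  then have C: "C \<subseteq> W" "independent C" "span C = W"
    unfolding C_def by (metis (mono_tags, lifting) someI_ex)+
  have "trace_on scale W f = (\<Sum>b\<in>C. representation C (f b) b)"
    unfolding trace_on_def Let_def C_def ..
  also have "\<dots> = (\<Sum>b\<in>B. representation B (f b) b)"
    using B C inv by (intro trace_basis_independent f) auto
  finally show ?thesis .
qed

text \<open>Extend a basis of \<open>W\<close> to one of \<open>U\<close>. Every \<open>f b\<close>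
  has coordinates only along the vectors from \<open>W\<close>, so the added vectors contribute
  nothing to the diagonal.\<close>

lemma trace_on_image_subset:
  assumes f: "endo f" and U: "subspace U" and W: "subspace W" and "W \<subseteq> U" and "f ` U \<subseteq> W"
  shows "trace_on scale U f = trace_on scale W f"
proof -
  obtain C where C: "C \<subseteq> W" "independent C" "W \<subseteq> span C"
    by (rule basis_exists[of W])
  obtain B where B: "C \<subseteq> B" "B \<subseteq> U" "independent B" "U \<subseteq> span B"
    by (rule maximal_independent_subset_extend[of C U]) (use C \<open>W \<subseteq> U\<close> in auto)
  have sC: "span C = W" and sB: "span B = U"
    using span_subspace[OF C(1,3) W] span_subspace[OF B(2,4) U] by simp_all
  have rep: "representation B (f b) = representation C (f b)" if "b \<in> B" for b
  proof -
    have "f b \<in> span C"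
      using that B(2) assms(5) sC by blast
    then show ?thesis
      using B by (intro representation_extend)
  qed
  have "trace_on scale U f = (\<Sum>b\<in>B. representation B (f b) b)"
    using assms by (intro trace_on_eq_sum f B sB) auto
  also have "\<dots> = (\<Sum>b\<in>B. representation C (f b) b)"
    by (intro sum.cong) (auto simp: rep)
  also have "\<dots> = (\<Sum>b\<in>C. representation C (f b) b)"
    using B by (intro sum.mono_neutral_right) (auto simp: finiteI_independent dest: representation_ne_zero)
  also have "\<dots> = trace_on scale W f"
    using assms by (intro trace_on_eq_sum[symmetric] f C sC) auto
  finally show ?thesis .
qed

lemma trace_eq_sum_Basis:
  "endo f \<Longrightarrow> trace_on scale UNIV f = (\<Sum>b\<in>Basis. representation Basis (f b) b)"
  by (intro trace_on_eq_sum) (auto simp: independent_Basis span_Basis)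

lemma trace_add:
  "endo f \<Longrightarrow> endo g \<Longrightarrow>
    trace_on scale UNIV (\<lambda>x. f x + g x) = trace_on scale UNIV f + trace_on scale UNIV g"
  by (simp add: trace_eq_sum_Basis endo_compose_add representation_add independent_Basis
      span_Basis sum.distrib)

lemma trace_diff:
  "endo f \<Longrightarrow> endo g \<Longrightarrow>
    trace_on scale UNIV (\<lambda>x. f x - g x) = trace_on scale UNIV f - trace_on scale UNIV g"
  by (simp add: trace_eq_sum_Basis endo_compose_sub representation_diff independent_Basis
      span_Basis sum_subtractf)

lemma trace_scale:
  assumes f: "endo f"
  shows "trace_on scale UNIV (\<lambda>x. c *s f x) = c * trace_on scale UNIV f"
proof -
  have "endo (\<lambda>x. c *s f x)"
    using f by (intro endoI) (simp_all add: endo_add endo_scale scale_right_distrib mult.commute)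
  then show ?thesis
    using f by (simp add: trace_eq_sum_Basis representation_scale independent_Basis
      span_Basis sum_distrib_left)
qed

lemma trace_commute:
  assumes f: "endo f" and g: "endo g"
  shows "trace_on scale UNIV (f \<circ> g) = trace_on scale UNIV (g \<circ> f)"
proof -
  have *: "trace_on scale UNIV (f \<circ> g)
      = (\<Sum>b\<in>Basis. \<Sum>c\<in>Basis. representation Basis (g b) c * representation Basis (f c) b)"
    if f: "endo f" and g: "endo g" for f g
  proof -
    have "trace_on scale UNIV (f \<circ> g)
        = (\<Sum>b\<in>Basis. representation Basis (f (\<Sum>c\<in>Basis. representation Basis (g b) c *s c)) b)"
      using f g by (simp add: trace_eq_sum_Basis endo_comp representation_expansion
          independent_Basis span_Basis)
    also have "\<dots> = (\<Sum>b\<in>Basis. representation Basis (\<Sum>c\<in>Basis. representation Basis (g b) c *s f c) b)"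
      using f by (simp add: endo_sum endo_scale)
    also have "\<dots> = (\<Sum>b\<in>Basis. \<Sum>c\<in>Basis. representation Basis (g b) c * representation Basis (f c) b)"
      by (intro sum.cong refl representation_sum_scale) (auto simp: independent_Basis span_Basis)
    finally show ?thesis .
  qed
  show ?thesis
    unfolding *[OF f g] *[OF g f] by (subst sum.swap) (simp add: mult.commute)
qed

lemma funpow_vanish_mono: "endo f \<Longrightarrow> (f ^^ m) v = 0 \<Longrightarrow> m \<le> n \<Longrightarrow> (f ^^ n) v = 0"
  by (metis comp_apply endo_0 endo_funpow funpow_add le_Suc_ex add.commute)

text \<open>The trace is carried down the chain of images \<open>range (f ^^ i)\<close>, which ends
  at \<open>{0}\<close>.\<close>

lemma trace_locally_nilpotent:
  assumes f: "endo f" and nil: "\<And>v. \<exists>n. (f ^^ n) v = 0"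
  shows "trace_on scale UNIV f = 0"
proof -
  obtain n where n: "\<And>v. (f ^^ n v) v = 0"
    using nil by metis
  \<comment> \<open>A common exponent for the finitely many basis vectors; the inserted 0 keeps
    \<open>Max\<close> meaningful for an empty basis.\<close>
  define N where "N = Max (insert 0 (n ` Basis))"
  have "(f ^^ N) b = 0" if "b \<in> Basis" for b
    using that by (intro funpow_vanish_mono[OF f n]) (auto simp: N_def finite_Basis)
  then have "(f ^^ N) v = 0" for v
    using E.linear_eq_0_on_span[OF endo_funpow[OF f, of N], of Basis v] by (simp add: span_Basis)
  then have rN: "range (f ^^ N) = {0}"
    by auto
  have "trace_on scale UNIV f = trace_on scale (range (f ^^ i)) f" for i
  proof (induction i)
    case (Suc i)
    have "range (f ^^ Suc i) = f ` range (f ^^ i)"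
      by auto
    moreover have "range (f ^^ Suc i) \<subseteq> range (f ^^ i)"
      by (auto simp: funpow_swap1)
    ultimately have "trace_on scale (range (f ^^ i)) f = trace_on scale (range (f ^^ Suc i)) f"
      by (intro trace_on_image_subset f subspace_image_endo endo_funpow subspace_UNIV) auto
    with Suc show ?case by simp
  qed simp
  from this[of N] have "trace_on scale UNIV f = trace_on scale {0} f"
    using rN by simp
  also have "\<dots> = 0"
    using f by (subst trace_on_eq_sum[where B = "{}"]) (auto simp: endo_0 independent_empty)
  finally show ?thesis .
qed

text \<open>Dimensions are bounded, so a subspace of greatest dimension with \<open>P\<close> is
  maximal. This will supply the radical and both maximal subspaces in Engel's theorem.\<close>

lemma maximal_subspace:
  assumes "P W\<^sub>0" and "\<And>W. P W \<Longrightarrow> subspace W"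
  obtains W where "P W" "\<And>W'. P W' \<Longrightarrow> W \<subseteq> W' \<Longrightarrow> W' = W"
proof -
  have "\<exists>W. P W \<and> (\<forall>W'. P W' \<longrightarrow> dim W' \<le> dim W)"
    using assms(1) dim_subset_UNIV by (intro ex_has_greatest_nat[where b = "Suc dimension"]) (auto simp: less_Suc_eq_le)
  then show thesis
    by (metis assms(2) subspace_dim_equal that)
qed

subsection \<open>Generalised eigenspaces\<close>

abbreviation gev :: "('b \<Rightarrow> 'b) \<Rightarrow> 'a \<Rightarrow> 'b \<Rightarrow> bool" where
  "gev \<equiv> gen_eigen scale"

lemma gev_image: "endo X \<Longrightarrow> gev X a v \<Longrightarrow> gev X a (X v - a *s v)"
  by (erule gen_eigen.cases) (auto simp: endo_0 intro: gen_eigen.zero)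

lemma gev_scale:
  assumes X: "endo X"
  shows "gev X a v \<Longrightarrow> gev X a (c *s v)"
proof (induction rule: gen_eigen.induct)
  case (step v)
  have "X (c *s v) - a *s (c *s v) = c *s (X v - a *s v)"
    using X by (simp add: endo_scale algebra_simps)
  with step show ?case
    by (intro gen_eigen.step[of _ _ _ "c *s v"]) simp
qed (simp add: gen_eigen.zero)

lemma gev_add:
  assumes X: "endo X"
  shows "gev X a u \<Longrightarrow> gev X a v \<Longrightarrow> gev X a (u + v)"
proof (induction arbitrary: v rule: gen_eigen.induct)
  case (step u)
  have "X (u + v) - a *s (u + v) = (X u - a *s u) + (X v - a *s v)"
    using X by (simp add: endo_add algebra_simps)
  with step gev_image[OF X step.prems] show ?case
    by (intro gen_eigen.step[of _ _ _ "u + v"]) simp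
qed simp

lemma gev_diff: "endo X \<Longrightarrow> gev X a u \<Longrightarrow> gev X a v \<Longrightarrow> gev X a (u - v)"
  using gev_add[of X a u "(-1) *s v"] gev_scale[of X a v "-1"] by simp

lemma gev_apply:
  assumes X: "endo X" and v: "gev X a v"
  shows "gev X a (X v)"
  using gev_add[OF X gev_image[OF X v] gev_scale[OF X v], of a] by simp

lemma gev_sum: "endo X \<Longrightarrow> (\<And>i. i \<in> I \<Longrightarrow> gev X a (v i)) \<Longrightarrow> gev X a (sum v I)"
  by (induction I rule: infinite_finite_induct) (auto intro: gen_eigen.zero gev_add)

text \<open>\<open>X - a\<close> is onto on the generalised \<open>b\<close>-eigenspace. If
  \<open>u\<close> solves the equation for \<open>(X - b) w\<close>, then \<open>X - a\<close> maps
  \<open>w - u\<close> to \<open>(b - a) w\<close>, and rescaling finishes the step.\<close>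

lemma gev_solve:
  assumes X: "endo X" and ab: "a \<noteq> b"
  shows "gev X b w \<Longrightarrow> \<exists>u. gev X b u \<and> X u - a *s u = w"
proof (induction rule: gen_eigen.induct)
  case zero
  show ?case using X by (intro exI[of _ 0]) (simp add: gen_eigen.zero endo_0)
next
  case (step w)
  then obtain u where u: "gev X b u" "X u - a *s u = X w - b *s w" by blast
  define c where "c = 1 / (b - a)"
  have c: "c * (b - a) = 1" using ab by (simp add: c_def)
  have "X (c *s (w - u)) - a *s (c *s (w - u)) = c *s ((X w - a *s w) - (X u - a *s u))"
    using X by (simp add: endo_scale endo_diff algebra_simps)
  also have "\<dots> = (c * (b - a)) *s w"
    by (simp add: u(2) algebra_simps)
  finally have "X (c *s (w - u)) - a *s (c *s (w - u)) = w"
    by (simp add: c)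
  moreover have "gev X b (c *s (w - u))"
    using X u(1) gen_eigen.step[OF step.hyps] by (intro gev_scale gev_diff)
  ultimately show ?case by blast
qed

text \<open>By induction \<open>X v - b *s v\<close>, again an \<open>a\<close>-eigenvector, is
  zero; then \<open>v\<close> is an eigenvector for both \<open>a\<close> and
  \<open>b\<close>.\<close>

lemma gev_eigen_eq_0:
  assumes X: "endo X" and ab: "a \<noteq> b"
  shows "gev X b v \<Longrightarrow> X v = a *s v \<Longrightarrow> v = 0"
proof (induction rule: gen_eigen.induct)
  case (step v)
  then have "X (X v - b *s v) = a *s (X v - b *s v)"
    using X by (simp add: endo_diff endo_scale algebra_simps)
  then have "X v - b *s v = 0" by (rule step.IH)
  then have "(a - b) *s v = 0" using step.prems by (simp add: algebra_simps)
  with ab show ?case by simp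
qed simp

section \<open>Polynomials in an endomorphism and the existence of eigenvectors\<close>

lemma poly_apply_0 [simp]: "poly_apply scale X 0 v = 0"
  by (simp add: poly_apply_def)

lemma poly_apply_pCons:
  "endo X \<Longrightarrow> poly_apply scale X (pCons c p) v = c *s v + X (poly_apply scale X p v)"
  by (cases "p = 0"; cases "c = 0") (simp_all add: poly_apply_def endo_0)

lemma poly_apply_add:
  assumes X: "endo X"
  shows "poly_apply scale X (p + q) v = poly_apply scale X p v + poly_apply scale X q v"
proof (induction p arbitrary: q)
  case (pCons c p)
  obtain d q' where "q = pCons d q'" by (cases q)
  then show ?case
    by (simp add: poly_apply_pCons[OF X] pCons.IH[of q'] endo_add[OF X] scale_left_distrib)
qed simp

lemma poly_apply_smult:
  "endo X \<Longrightarrow> poly_apply scale X (smult c p) v = c *s poly_apply scale X p v"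
  by (induction p) (simp_all add: poly_apply_pCons endo_scale algebra_simps)

lemma poly_apply_linear_factor:
  "endo X \<Longrightarrow> poly_apply scale X ([:-a, 1:] * q) v
    = X (poly_apply scale X q v) - a *s poly_apply scale X q v"
  using poly_apply_add[of X "smult (-a) q" "pCons 0 q" v]
    poly_apply_smult[of X "-a" q v]
  by (simp add: poly_apply_pCons)

lemma poly_apply_monom: "endo X \<Longrightarrow> poly_apply scale X (monom 1 n) v = (X ^^ n) v"
  by (induction n) (simp_all add: monom_0 monom_Suc poly_apply_pCons endo_0)

text \<open>Otherwise no nontrivial combination of the iterates \<open>v, X v, X (X v), ...\<close>
  vanishes, and they exceed the dimension in number.\<close>

lemma exists_poly_apply_mem:
  assumes X: "endo X" and W: "subspace W"
  shows "\<exists>p. p \<noteq> 0 \<and> poly_apply scale X p v \<in> W"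
proof (rule ccontr)
  assume contra: "\<not> ?thesis"
  define S where "S n = (\<lambda>i. (X ^^ i) v) ` {..<n}" for n
  have S_Suc: "S (Suc n) = insert ((X ^^ n) v) (S n)" for n
    by (auto simp: S_def lessThan_Suc)
  \<comment> \<open>The span of the first \<open>n\<close> iterates consists of values of
    polynomials of degree below \<open>n\<close>.\<close>
  have poly: "\<exists>q. (\<forall>i\<ge>n. coeff q i = 0) \<and> poly_apply scale X q v = w" if "w \<in> span (S n)" for n w
    using that
  proof (induction rule: span_induct_alt)
    case base
    show ?case by (intro exI[of _ 0]) simp
  next
    case (step c x y)
    then obtain q where q: "\<forall>i\<ge>n. coeff q i = 0" "poly_apply scale X q v = y" by blast
    obtain i where i: "i < n" "x = (X ^^ i) v" using step.hyps(1) by (auto simp: S_def)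
    show ?case
      using X q i by (intro exI[of _ "smult c (monom 1 i) + q"])
        (auto simp: poly_apply_add poly_apply_smult poly_apply_monom)
  qed
  have new: "(X ^^ n) v \<notin> span (S n)" for n
  proof
    assume "(X ^^ n) v \<in> span (S n)"
    from poly[OF this] obtain q where q: "\<forall>i\<ge>n. coeff q i = 0" "poly_apply scale X q v = (X ^^ n) v"
      by blast
    define p where "p = monom 1 n + smult (-1) q"
    have "coeff p n = 1" using q by (simp add: p_def)
    then have "p \<noteq> 0" by auto
    moreover have "poly_apply scale X p v = 0"
      using X q by (simp only: p_def poly_apply_add poly_apply_smult poly_apply_monom) simp
    ultimately show False using contra subspace_0[OF W] by metis
  qed
  have fin: "finite (S n)" for n by (simp add: S_def)
  have "independent (S n) \<and> card (S n) = n" for n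
  proof (induction n)
    case (Suc n)
    have "(X ^^ n) v \<notin> S n" using new span_base by blast
    with Suc new show ?case
      by (simp add: S_Suc fin independent_insertI)
  qed (simp add: S_def independent_empty)
  then have "n \<le> dimension" for n
    by (metis dim_eq_card_independent dim_subset_UNIV)
  then show False by (meson Suc_n_not_le_n)
qed

text \<open>Take \<open>p\<close> of least degree with \<open>p(X) v\<close> in \<open>W\<close> and
  split off a root \<open>a\<close>. The value of the cofactor at \<open>v\<close> is the
  eigenvector modulo \<open>W\<close>.\<close>

lemma exists_eigenvector_mod:
  assumes closed: "alg_closed TYPE('a)" and X: "endo X" and W: "subspace W" and v: "v \<notin> W"
  obtains a u where "u \<notin> W" "X u - a *s u \<in> W"
proof -
  obtain p\<^sub>0 where "p\<^sub>0 \<noteq> 0 \<and> poly_apply scale X p\<^sub>0 v \<in> W"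
    using exists_poly_apply_mem[OF X W] by blast
  from ex_has_least_nat[where P = "\<lambda>p. p \<noteq> 0 \<and> poly_apply scale X p v \<in> W" and m = degree, OF this]
  obtain p where p: "p \<noteq> 0" "poly_apply scale X p v \<in> W"
    and least: "\<And>q. q \<noteq> 0 \<Longrightarrow> poly_apply scale X q v \<in> W \<Longrightarrow> degree p \<le> degree q"
    by blast
  \<comment> \<open>A nonzero constant would put \<open>v\<close> itself into
    \<open>W\<close>.\<close>
  have "degree p > 0"
  proof (rule ccontr)
    assume "\<not> degree p > 0"
    then obtain c where c: "p = [:c:]" by (metis degree_eq_zeroE neq0_conv)
    with p X have "c \<noteq> 0" "c *s v \<in> W" by (auto simp: poly_apply_pCons endo_0)
    then have "(1 / c) *s (c *s v) \<in> W" using W by (blast intro: subspace_scale)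
    with \<open>c \<noteq> 0\<close> v show False by simp
  qed
  then obtain a where "poly p a = 0" using closed unfolding alg_closed_def by blast
  then obtain q where q: "p = [:-a, 1:] * q" by (metis dvdE poly_eq_0_iff_dvd)
  with p(1) have q0: "q \<noteq> 0" by auto
  have "degree p = Suc (degree q)" unfolding q using q0 by (subst degree_mult_eq) auto
  then have "poly_apply scale X q v \<notin> W" using least[OF q0] by auto
  moreover have "X (poly_apply scale X q v) - a *s poly_apply scale X q v \<in> W"
    using p(2) X unfolding q by (simp only: poly_apply_linear_factor)
  ultimately show thesis by (rule that)
qed

text \<open>If the span were proper, an eigenvector \<open>u\<close> modulo it could be corrected by
  an element of the span to a genuine generalised eigenvector.\<close>

lemma span_gev:
  assumes closed: "alg_closed TYPE('a)" and X: "endo X"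
  shows "span {v. \<exists>a. gev X a v} = UNIV"
proof (rule ccontr)
  let ?W = "span {v. \<exists>a. gev X a v}"
  assume "?W \<noteq> UNIV"
  then obtain v where "v \<notin> ?W" by blast
  then obtain a u where u: "u \<notin> ?W" "X u - a *s u \<in> ?W"
    using exists_eigenvector_mod[OF closed X subspace_span] by metis
  \<comment> \<open>Modulo the image of the span under \<open>X - a\<close>, only the component for
    \<open>a\<close> survives: \<open>gev_solve\<close> removes every other one.\<close>
  have "\<exists>w'\<in>?W. gev X a (w - (X w' - a *s w'))" if "w \<in> ?W" for w
    using that
  proof (induction rule: span_induct_alt)
    case base
    show ?case using X by (intro bexI[of _ 0]) (simp_all add: endo_0 gen_eigen.zero span_zero)
  next
    case (step c x y)
    then obtain y' where y': "y' \<in> ?W" "gev X a (y - (X y' - a *s y'))" by blast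
    obtain b where b: "gev X b x" using step.hyps(1) by blast
    have "\<exists>x'\<in>?W. gev X a (x - (X x' - a *s x'))"
    proof (cases "a = b")
      case True
      with b X show ?thesis by (intro bexI[of _ 0]) (simp_all add: endo_0 span_zero)
    next
      case False
      with gev_solve[OF X False b] obtain x' where "gev X b x'" "X x' - a *s x' = x" by blast
      then show ?thesis by (intro bexI[of _ x']) (auto simp: gen_eigen.zero intro: span_base)
    qed
    then obtain x' where x': "x' \<in> ?W" "gev X a (x - (X x' - a *s x'))" by blast
    have "c *s x + y - (X (c *s x' + y') - a *s (c *s x' + y'))
        = c *s (x - (X x' - a *s x')) + (y - (X y' - a *s y'))"
      using X by (simp add: endo_add endo_scale algebra_simps)
    with gev_add[OF X gev_scale[OF X x'(2)] y'(2), of c]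
    have "gev X a (c *s x + y - (X (c *s x' + y') - a *s (c *s x' + y')))"
      by (simp only:)
    with x'(1) y'(1) show ?case
      by (blast intro: span_add span_scale)
  qed
  from this[OF u(2)] obtain w where w: "w \<in> ?W" "gev X a (X u - a *s u - (X w - a *s w))" by blast
  have "gev X a (X (u - w) - a *s (u - w))"
    using w(2) X by (simp add: endo_diff algebra_simps)
  then have "u - w \<in> ?W" using gen_eigen.step by (blast intro: span_base)
  with w(1) u(1) show False by (metis diff_add_cancel span_add)
qed

text \<open>The outer induction removes eigenvalues. The inner one applies \<open>X - c\<close> to
  the whole relation, which lowers the \<open>c\<close>-component and is injective on the other
  generalised eigenspaces.\<close>

lemma gev_independent:
  assumes X: "endo X"
  shows "finite A \<Longrightarrow> (\<And>a. a \<in> A \<Longrightarrow> gev X a (v a)) \<Longrightarrow> (\<Sum>a\<in>A. v a) = 0 \<Longrightarrow> a \<in> A \<Longrightarrow> v a = 0"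
proof (induction A arbitrary: v a rule: finite_induct)
  case (insert c A)
  have *: "w = 0 \<and> (\<forall>b\<in>A. u b = 0)"
    if "gev X c w" "\<And>b. b \<in> A \<Longrightarrow> gev X b (u b)" "w + (\<Sum>b\<in>A. u b) = 0" for w u
    using that
  proof (induction arbitrary: u rule: gen_eigen.induct)
    case zero
    from zero(2) have "sum u A = 0" by simp
    with insert.IH[of u] zero(1) show ?case by blast
  next
    case (step w)
    let ?u = "\<lambda>b. X (u b) - c *s u b"
    have "gev X b (?u b)" if "b \<in> A" for b
      using step.prems(1)[OF that] by (intro gev_diff[OF X] gev_apply[OF X] gev_scale[OF X])
    moreover have "(X w - c *s w) + (\<Sum>b\<in>A. ?u b) = 0"
    proof -
      have "(X w - c *s w) + (\<Sum>b\<in>A. ?u b) = X (w + sum u A) - c *s (w + sum u A)"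
        using X by (simp add: endo_add endo_sum sum_subtractf scale_sum_right algebra_simps)
      also have "\<dots> = 0" by (simp only: step.prems(2) endo_0[OF X] scale_zero_right diff_self)
      finally show ?thesis .
    qed
    ultimately have *: "X w - c *s w = 0 \<and> (\<forall>b\<in>A. ?u b = 0)" by (rule step.IH)
    have "u b = 0" if b: "b \<in> A" for b
    proof (rule gev_eigen_eq_0[OF X _ step.prems(1)[OF b]])
      show "c \<noteq> b" using b insert.hyps(2) by blast
      show "X (u b) = c *s u b" using * b by simp
    qed
    with step.prems(2) show ?case by simp
  qed
  have "v c = 0 \<and> (\<forall>b\<in>A. v b = 0)"
  proof (rule *)
    show "gev X c (v c)" "\<And>b. b \<in> A \<Longrightarrow> gev X b (v b)"
      using insert.prems(1) by blast+
    show "v c + (\<Sum>b\<in>A. v b) = 0"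
      using insert.prems(2) by (simp only: sum.insert[OF insert.hyps])
  qed
  with insert.prems(3) show ?case by blast
qed simp

lemma gev_eigenbasis:
  assumes closed: "alg_closed TYPE('a)" and X: "endo X"
  obtains B \<mu> where "independent B" "span B = UNIV" "\<And>b. b \<in> B \<Longrightarrow> gev X (\<mu> b) b"
proof -
  obtain B where B: "B \<subseteq> {v. \<exists>a. gev X a v}" "independent B" "{v. \<exists>a. gev X a v} \<subseteq> span B"
    using maximal_independent_subset by metis
  have "span B = UNIV"
    using span_minimal[OF B(3) subspace_span] span_gev[OF closed X] by auto
  moreover have "gev X (SOME a. gev X a b) b" if "b \<in> B" for b
    using that B(1) by (metis (mono_tags, lifting) mem_Collect_eq someI_ex subsetD)
  ultimately show thesis using B(2) by (intro that)
qed

text \<open>\<open>D\<close> is prescribed on a basis only; independence of the generalised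
  eigenspaces shows that it acts by \<open>h a\<close> on all of the one for
  \<open>a\<close>.\<close>

lemma diagonal_endo:
  assumes X: "endo X" and B: "independent B" "span B = UNIV"
    and \<mu>: "\<And>b. b \<in> B \<Longrightarrow> gev X (\<mu> b) b"
  obtains D where "endo D" "\<And>a v. gev X a v \<Longrightarrow> D v = h a *s v"
    "trace_on scale UNIV D = (\<Sum>b\<in>B. h (\<mu> b))"
proof -
  define D where "D = E.construct B (\<lambda>b. h (\<mu> b) *s b)"
  have D: "endo D" unfolding D_def by (rule E.linear_construct[OF B(1)])
  have DB: "D b = h (\<mu> b) *s b" if "b \<in> B" for b
    unfolding D_def by (rule E.construct_basis[OF B(1) that])
  have fin: "finite B" using B(1) by (rule finiteI_independent)
  have "D v = h a *s v" if v: "gev X a v" for a v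
  proof -
    let ?r = "representation B v"
    \<comment> \<open>The component of \<open>v\<close> in the generalised
      \<open>c\<close>-eigenspace.\<close>
    define w where "w c = (\<Sum>b\<in>{b\<in>B. \<mu> b = c}. ?r b *s b)" for c
    \<comment> \<open>\<open>a\<close> is inserted because it need not be the eigenvalue of any
      basis vector; in that case \<open>v\<close> turns out to be zero.\<close>
    define A where "A = insert a (\<mu> ` B)"
    have A: "finite A" "\<mu> ` B \<subseteq> A" "a \<in> A" using fin by (auto simp: A_def)
    have expand: "(\<Sum>b\<in>B. ?r b *s b) = v" using B by (simp add: representation_expansion)
    have "(\<Sum>c\<in>A. w c - (if c = a then v else 0)) = (\<Sum>c\<in>A. w c) - v"
      using A by (simp add: sum_subtractf sum.delta)
    also have "(\<Sum>c\<in>A. w c) = v"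
      by (simp only: w_def sum.group[OF fin A(1,2)] expand)
    finally have sum0: "(\<Sum>c\<in>A. w c - (if c = a then v else 0)) = 0" by simp
    have "gev X c (w c)" for c
      unfolding w_def using X \<mu> by (intro gev_sum gev_scale) auto
    then have "gev X c (w c - (if c = a then v else 0))" for c
      using v X by (auto intro: gev_diff)
    from gev_independent[OF X A(1) this sum0]
    have w: "w c = (if c = a then v else 0)" if "c \<in> A" for c
      using that by simp
    have "D v = (\<Sum>b\<in>B. ?r b *s D b)"
      using endo_sum[OF D, of "\<lambda>b. ?r b *s b" B] D by (simp add: expand endo_scale)
    also have "\<dots> = (\<Sum>c\<in>A. \<Sum>b\<in>{b\<in>B. \<mu> b = c}. ?r b *s D b)"
      by (simp only: sum.group[OF fin A(1,2)])
    also have "\<dots> = (\<Sum>c\<in>A. h c *s w c)"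
      unfolding w_def scale_sum_right by (intro sum.cong refl) (simp add: DB mult.commute)
    also have "\<dots> = (\<Sum>c\<in>A. if c = a then h a *s v else 0)"
      by (intro sum.cong refl) (simp add: w)
    also have "\<dots> = h a *s v" using A by (simp add: sum.delta)
    finally show ?thesis .
  qed
  moreover have "trace_on scale UNIV D = (\<Sum>b\<in>B. h (\<mu> b))"
  proof -
    have "trace_on scale UNIV D = (\<Sum>b\<in>B. representation B (D b) b)"
      using D B by (intro trace_on_eq_sum) auto
    also have "\<dots> = (\<Sum>b\<in>B. h (\<mu> b))"
      using B by (intro sum.cong refl) (simp add: DB representation_scale representation_basis)
    finally show ?thesis .
  qed
  ultimately show thesis using D by (intro that)
qed

lemma locally_nilpotent_span:
  assumes F: "endo F" and G: "span G = UNIV" and nil: "\<And>v. v \<in> G \<Longrightarrow> \<exists>n. (F ^^ n) v = 0"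
  shows "\<exists>n. (F ^^ n) v = 0"
proof -
  have "v \<in> span G" using G by simp
  then show ?thesis
  proof (induction rule: span_induct_alt)
    case base
    show ?case by (intro exI[of _ 0]) simp
  next
    case (step c x y)
    then obtain m n where "(F ^^ m) x = 0" "(F ^^ n) y = 0" using nil by blast
    then have "(F ^^ max m n) x = 0" "(F ^^ max m n) y = 0"
      using funpow_vanish_mono[OF F] by (metis max.cobounded1, metis max.cobounded2)
    then have "(F ^^ max m n) (c *s x + y) = 0"
      using endo_funpow[OF F, of "max m n"] by (simp add: endo_add endo_scale)
    then show ?case by blast
  qed
qed

end

section \<open>A trace criterion for nilpotency\<close>

text \<open>The field is viewed as a vector space over its rational subfield, and the assignment of
  1 to \<open>a\<close> is extended linearly.\<close>

lemma exists_rat_functional: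
  fixes a :: "'k::field_char_0"
  assumes "a \<noteq> 0"
  obtains f :: "'k \<Rightarrow> rat" where "\<And>x y. f (x + y) = f x + f y"
    "\<And>q x. f (of_rat q * x) = q * f x" "f a = 1"
proof -
  interpret Q: vector_space_pair "\<lambda>q x. of_rat q * x :: 'k" "(*) :: rat \<Rightarrow> rat \<Rightarrow> rat"
    by unfold_locales (simp_all add: algebra_simps of_rat_add of_rat_mult)
  have "Q.vs1.independent {a}" using assms by simp
  from Q.linear_independent_extend[OF this, of "\<lambda>_. 1"]
  obtain f where f: "Vector_Spaces.linear (\<lambda>q x. of_rat q * x) (*) f" "f a = 1" by auto
  show thesis
    by (rule that[OF Q.linear_add[OF f(1)] Q.linear_scale[OF f(1)] f(2)])
qed

locale char_0_space = finite_dimensional_vector_space scale Basis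
  for scale :: "'k::field_char_0 \<Rightarrow> 'v::ab_group_add \<Rightarrow> 'v" (infixr \<open>*s\<close> 75) and Basis
begin

text \<open>The linear algebra behind Cartan's criterion: rational functionals detect every nonzero
  eigenvalue of \<open>X\<close>.\<close>

lemma locally_nilpotent_if_traces_0:
  assumes closed: "alg_closed TYPE('k)" and X: "endo X"
    and tr: "\<And>f D. (\<And>x y. f (x + y) = f x + f y) \<Longrightarrow> endo D \<Longrightarrow>
      (\<And>a v. gev X a v \<Longrightarrow> D v = of_rat (f a) *s v) \<Longrightarrow> trace_on scale UNIV (X \<circ> D) = 0"
  shows "\<exists>n. (X ^^ n) v = 0"
proof -
  obtain B \<mu> where B: "independent B" "span B = UNIV" and \<mu>: "\<And>b. b \<in> B \<Longrightarrow> gev X (\<mu> b) b"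
    using gev_eigenbasis[OF closed X] by metis
  have fin: "finite B" using B(1) by (rule finiteI_independent)
  have "\<mu> b = 0" if b: "b \<in> B" for b
  proof (rule ccontr)
    assume "\<mu> b \<noteq> 0"
    then obtain f where f: "\<And>x y. f (x + y) = f x + f y" "\<And>q x. f (of_rat q * x) = q * f x"
      and fb: "f (\<mu> b) = 1"
      by (rule exists_rat_functional) blast
    obtain D where D: "endo D" "\<And>a v. gev X a v \<Longrightarrow> D v = of_rat (f a) *s v"
      using diagonal_endo[OF X B \<mu>, of "\<lambda>a. of_rat (f a)"] by metis
    obtain S where S: "endo S" "\<And>a v. gev X a v \<Longrightarrow> S v = (of_rat (f a) * a) *s v"
      and trS: "trace_on scale UNIV S = (\<Sum>b\<in>B. of_rat (f (\<mu> b)) * \<mu> b)"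
      using diagonal_endo[OF X B \<mu>, of "\<lambda>a. of_rat (f a) * a"] by metis
    \<comment> \<open>\<open>S\<close> is the diagonal part of \<open>X \<circ> D\<close>, so the
      difference is nilpotent and \<open>S\<close> inherits the trace zero.\<close>
    define F where "F v = (X \<circ> D) v - S v" for v
    have XD: "endo (X \<circ> D)" using D(1) X by (rule endo_comp)
    have F: "endo F" unfolding F_def using XD S(1) by (rule endo_compose_sub)
    have nilF: "\<exists>n. (F ^^ n) v = 0" if "gev X a v" for a v
      using that
    proof (induction rule: gen_eigen.induct)
      case zero
      show ?case by (intro exI[of _ 0]) simp
    next
      case (step v)
      then obtain n where n: "(F ^^ n) (X v - a *s v) = 0" by blast
      \<comment> \<open>On a generalised eigenspace \<open>F\<close> is a multiple of the nilpotent
        \<open>X - a\<close>.\<close>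
      have "F v = of_rat (f a) *s (X v - a *s v)"
        using D(2) S(2) X gen_eigen.step[OF step.hyps]
        by (simp add: F_def endo_scale algebra_simps)
      then have "(F ^^ Suc n) v = 0"
        using n endo_funpow[OF F, of n] by (simp add: funpow_swap1 endo_scale)
      then show ?case by blast
    qed
    have "\<exists>n. (F ^^ n) v = 0" for v
      by (rule locally_nilpotent_span[OF F B(2) nilF[OF \<mu>]])
    then have "trace_on scale UNIV F = 0" by (rule trace_locally_nilpotent[OF F])
    moreover have "trace_on scale UNIV F = 0 - trace_on scale UNIV S"
      using trace_diff[OF XD S(1)] tr[OF f(1) D] unfolding F_def by simp
    ultimately have "(\<Sum>b\<in>B. of_rat (f (\<mu> b)) * \<mu> b) = 0" using trS by simp
    \<comment> \<open>The coefficients are rational, so \<open>f\<close> passes through them and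
      leaves a sum of rational squares.\<close>
    moreover have "f (\<Sum>b\<in>B. of_rat (f (\<mu> b)) * \<mu> b) = (\<Sum>b\<in>B. f (\<mu> b) * f (\<mu> b))"
    proof -
      have f0: "f 0 = 0" using f(1)[of 0 0] by simp
      have "f (sum g A) = (\<Sum>a\<in>A. f (g a))" if "finite A" for g and A :: "'v set"
        using that by (induction A rule: finite_induct) (auto simp: f(1) f0)
      from this[OF fin] show ?thesis by (simp add: f(2))
    qed
    moreover have "f 0 = 0" using f(1)[of 0 0] by simp
    ultimately have "(\<Sum>b\<in>B. f (\<mu> b) * f (\<mu> b)) = 0" by simp
    then have "f (\<mu> b) * f (\<mu> b) = 0"
      using b by (subst (asm) sum_nonneg_eq_0_iff[OF fin]) auto
    with fb show False by simp
  qed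
  then have nil: "gev X 0 b" if "b \<in> B" for b using \<mu> that by metis
  have nilX: "\<exists>n. (X ^^ n) w = 0" if "gev X 0 w" for w
    using that
  proof (induction rule: gen_eigen.induct)
    case zero
    show ?case by (intro exI[of _ 0]) simp
  next
    case (step w)
    then obtain n where "(X ^^ n) (X w) = 0" by auto
    then have "(X ^^ Suc n) w = 0" by (simp add: funpow_swap1)
    then show ?case by blast
  qed
  show ?thesis by (rule locally_nilpotent_span[OF X B(2) nilX[OF nil]])
qed

end

subsection \<open>The Killing form of a Leibniz algebra\<close>

locale leibniz = char_0_space scale Basis
  for scale :: "'k::field_char_0 \<Rightarrow> 'v::ab_group_add \<Rightarrow> 'v" (infixr \<open>*s\<close> 75) and Basis +
  fixes br :: "'v \<Rightarrow> 'v \<Rightarrow> 'v"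
  assumes leibniz: "leibniz_algebra scale br"
begin

lemma endo_br: "endo (br x)" "endo (\<lambda>x. br x y)"
  using leibniz by (auto simp: leibniz_algebra_def)

lemma endo_ad: "endo (ad br x)"
  using endo_br(2) by (simp add: ad_def)

lemma br_simps:
  "br (x + y) z = br x z + br y z" "br z (x + y) = br z x + br z y"
  "br (x - y) z = br x z - br y z" "br z (x - y) = br z x - br z y"
  "br (c *s x) z = c *s br x z" "br z (c *s x) = c *s br z x"
  "br 0 z = 0" "br z 0 = 0"
  using endo_br by (simp_all add: endo_add endo_diff endo_scale endo_0
      endo_add[OF endo_br(2)] endo_diff[OF endo_br(2)] endo_scale[OF endo_br(2)] endo_0[OF endo_br(2)])

lemma br_br: "br x (br y z) = br (br x y) z - br (br x z) y"
  using leibniz by (simp add: leibniz_algebra_def)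

text \<open>The Leibniz identity rearranged: \<open>ad br x\<close> is a derivation.\<close>

lemma br_derivation: "br (br u v) x = br (br u x) v + br u (br v x)"
  by (simp add: br_br)

lemma br_square [simp]: "br z (br x x) = 0"
  by (simp add: br_br)

lemma br_skew: "br z (br x y) = - br z (br y x)"
  by (simp add: br_br)

text \<open>The commutator comes in reversed order because \<open>ad\<close> is right
  multiplication.\<close>

lemma ad_br: "ad br (br y z) = (\<lambda>v. (ad br z \<circ> ad br y) v - (ad br y \<circ> ad br z) v)"
  by (simp add: ad_def br_br)

lemma ad_scale_add: "ad br (c *s x + y) = (\<lambda>v. c *s ad br x v + ad br y v)"
  by (simp add: ad_def br_simps)

lemma endo_scaled: "endo f \<Longrightarrow> endo (\<lambda>v. c *s f v)"
  by (intro endoI) (simp_all add: endo_add endo_scale scale_right_distrib mult.commute)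

lemma endo_o: "endo f \<Longrightarrow> endo g \<Longrightarrow> endo (f \<circ> g)"
  using endo_comp by blast

text \<open>Invariance of the form: after expanding both brackets, the traces differ only by a
  cyclic shift of \<open>ad br y\<close>.\<close>

lemma killing_br: "killing scale br (br x y) z = killing scale br x (br y z)"
proof -
  let ?t = "trace_on scale UNIV" and ?X = "ad br x" and ?Y = "ad br y" and ?Z = "ad br z"
  have "ad br (br x y) \<circ> ?Z = (\<lambda>v. (?Y \<circ> (?X \<circ> ?Z)) v - (?X \<circ> (?Y \<circ> ?Z)) v)"
    by (simp add: ad_br fun_eq_iff)
  then have 1: "killing scale br (br x y) z = ?t (?Y \<circ> (?X \<circ> ?Z)) - ?t (?X \<circ> (?Y \<circ> ?Z))"
    by (simp add: killing_def trace_diff endo_o endo_ad del: comp_apply)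
  have "?X \<circ> ad br (br y z) = (\<lambda>v. ((?X \<circ> ?Z) \<circ> ?Y) v - (?X \<circ> (?Y \<circ> ?Z)) v)"
    by (simp add: ad_br fun_eq_iff endo_diff[OF endo_ad])
  then have 2: "killing scale br x (br y z) = ?t ((?X \<circ> ?Z) \<circ> ?Y) - ?t (?X \<circ> (?Y \<circ> ?Z))"
    by (simp add: killing_def trace_diff endo_o endo_ad del: comp_apply)
  show ?thesis
    unfolding 1 2 using trace_commute[of ?Y "?X \<circ> ?Z"] by (simp add: endo_o endo_ad)
qed

lemma killing_scale_add:
  "killing scale br (c *s x + y) z = c * killing scale br x z + killing scale br y z"
proof -
  have "ad br (c *s x + y) \<circ> ad br z = (\<lambda>v. c *s (ad br x \<circ> ad br z) v + (ad br y \<circ> ad br z) v)"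
    by (simp add: ad_scale_add fun_eq_iff)
  then show ?thesis
    by (simp add: killing_def trace_add trace_scale endo_scaled endo_o endo_ad del: comp_apply)
qed

lemma ad_eq_0_killing: "(\<And>v. br v x = 0) \<Longrightarrow> killing scale br x y = 0"
proof -
  assume "\<And>v. br v x = 0"
  then have "ad br x \<circ> ad br y = (\<lambda>v. 0 *s (ad br x \<circ> ad br y) v)"
    by (simp add: ad_def fun_eq_iff)
  then show ?thesis
    unfolding killing_def using trace_scale[OF endo_o[OF endo_ad endo_ad], of 0 x y] by simp
qed

lemma lideal_ker_killing: "lideal scale br (ker_killing scale br)"
  unfolding lideal_def
proof (intro conjI ballI allI)
  have 0: "0 \<in> ker_killing scale br"
    by (simp add: ker_killing_def ad_eq_0_killing br_simps)
  have sc: "c *s x + y \<in> ker_killing scale br"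
    if "x \<in> ker_killing scale br" "y \<in> ker_killing scale br" for c x y
    using that by (simp add: ker_killing_def killing_scale_add)
  show "subspace (ker_killing scale br)"
    unfolding subspace_def using 0 sc[of _ _ 1] sc[of _ 0] by auto
  fix x y assume x: "x \<in> ker_killing scale br"
  then show xy: "br x y \<in> ker_killing scale br"
    by (simp add: ker_killing_def killing_br)
  \<comment> \<open>\<open>br y x\<close> need not equal \<open>- br x y\<close>, but by
    \<open>br_skew\<close> both have the same right multiplication. The summand 0 fits the shape of
    \<open>sc\<close>.\<close>
  have "ad br (br y x) = ad br ((-1) *s br x y + 0)"
    using br_skew[of _ y x] by (simp add: ad_def br_simps fun_eq_iff) (metis add.inverse_inverse br_simps(6) scale_minus_left scale_one)
  then have "killing scale br (br y x) z = killing scale br ((-1) *s br x y + 0) z" for z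
    unfolding killing_def by simp
  with sc[OF xy 0, of "-1"] show "br y x \<in> ker_killing scale br"
    by (simp add: ker_killing_def)
qed

section \<open>Derivations attached to the eigenvalues of a right multiplication\<close>

text \<open>As \<open>ad br x\<close> is a derivation, \<open>ad br x - (a + b)\<close> acts on
  \<open>br u v\<close> by \<open>ad br x - a\<close> on \<open>u\<close> plus
  \<open>ad br x - b\<close> on \<open>v\<close>; hence the nested induction.\<close>

lemma gev_br:
  assumes u: "gev (ad br x) a u" and v: "gev (ad br x) b v"
  shows "gev (ad br x) (a + b) (br u v)"
  using u v
proof (induction arbitrary: v rule: gen_eigen.induct)
  case zero
  then show ?case by (simp add: br_simps gen_eigen.zero)
next
  case (step u)
  note outer = step.IH
  show ?case using step.prems
  proof (induction rule: gen_eigen.induct)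
    case zero
    then show ?case by (simp add: br_simps gen_eigen.zero)
  next
    case (step v)
    have "ad br x (br u v) - (a + b) *s br u v
        = br (ad br x u - a *s u) v + br u (ad br x v - b *s v)"
      by (simp add: ad_def br_simps br_derivation[of u v x] algebra_simps)
    moreover have "gev (ad br x) (a + b) \<dots>"
      using outer[OF gen_eigen.step[OF step.hyps]] step.IH by (intro gev_add endo_ad)
    ultimately show ?case by (intro gen_eigen.step[of _ _ _ "br u v"]) simp
  qed
qed

text \<open>For generalised eigenvectors both sides equal \<open>f (a + b)\<close> times
  \<open>br u v\<close>, by additivity of \<open>f\<close>; bilinearity does the rest.\<close>

lemma diagonal_derivation:
  assumes closed: "alg_closed TYPE('k)" and D: "endo D"
    and f: "\<And>a b. f (a + b) = f a + f b"
    and Df: "\<And>a v. gev (ad br x) a v \<Longrightarrow> D v = f a *s v"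
  shows "D (br u v) = br (D u) v + br u (D v)"
proof -
  let ?G = "{v. \<exists>a. gev (ad br x) a v}"
  have *: "D (br u v) = br (D u) v + br u (D v)" if u: "u \<in> ?G" for u v
  proof -
    have "v \<in> span ?G" using span_gev[OF closed endo_ad] by simp
    then show ?thesis
    proof (induction rule: span_induct_alt)
      case base
      show ?case using D by (simp add: br_simps endo_0)
    next
      case (step c y z)
      then obtain a b where "gev (ad br x) a u" "gev (ad br x) b y" using u by blast
      then have "D (br u y) = br (D u) y + br u (D y)"
        using gev_br[of x a u b y] by (simp add: Df f br_simps algebra_simps)
      with step D show ?case by (simp add: br_simps endo_add endo_scale algebra_simps)
    qed
  qed
  have "u \<in> span ?G" using span_gev[OF closed endo_ad] by simp
  then show ?thesis
  proof (induction rule: span_induct_alt)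
    case base
    show ?case using D by (simp add: br_simps endo_0)
  next
    case (step c y z)
    with * D show ?case by (simp add: br_simps endo_add endo_scale algebra_simps)
  qed
qed

text \<open>With \<open>U\<close>, \<open>V\<close> the right multiplications by \<open>u\<close>,
  \<open>v\<close>, cyclicity turns the trace of \<open>(V U - U V) D\<close> into that of
  \<open>V (U D - D U)\<close>, and \<open>U D - D U\<close> is
  \<open>- ad br (D u)\<close>.\<close>

lemma trace_ad_br_derivation:
  assumes D: "endo D" and der: "\<And>u v. D (br u v) = br (D u) v + br u (D v)"
  shows "trace_on scale UNIV (ad br (br u v) \<circ> D) = - killing scale br v (D u)"
proof -
  let ?t = "trace_on scale UNIV" and ?U = "ad br u" and ?V = "ad br v"
  have "ad br (br u v) \<circ> D = (\<lambda>w. (?V \<circ> (?U \<circ> D)) w - (?U \<circ> (?V \<circ> D)) w)"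
    by (simp add: ad_br fun_eq_iff)
  then have "?t (ad br (br u v) \<circ> D) = ?t (?V \<circ> (?U \<circ> D)) - ?t (?U \<circ> (?V \<circ> D))"
    by (simp add: trace_diff endo_o endo_ad D del: comp_apply)
  also have "\<dots> = ?t (?V \<circ> (?U \<circ> D)) - ?t (?V \<circ> (D \<circ> ?U))"
    using trace_commute[of ?U "?V \<circ> D"] by (simp add: endo_o endo_ad D comp_assoc)
  also have "\<dots> = ?t (\<lambda>w. (?V \<circ> (?U \<circ> D)) w - (?V \<circ> (D \<circ> ?U)) w)"
    by (simp add: trace_diff endo_o endo_ad D del: comp_apply)
  also have "(\<lambda>w. (?V \<circ> (?U \<circ> D)) w - (?V \<circ> (D \<circ> ?U)) w) = (\<lambda>w. (-1) *s (?V \<circ> ad br (D u)) w)"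
    by (simp add: ad_def fun_eq_iff der br_simps)
  also have "?t \<dots> = (-1) * ?t (?V \<circ> ad br (D u))"
    by (rule trace_scale[OF endo_o[OF endo_ad endo_ad]])
  finally show ?thesis by (simp only: killing_def mult_minus1)
qed

lemma ad_locally_nilpotent:
  assumes closed: "alg_closed TYPE('k)"
    and x: "x \<in> brk scale br (ker_killing scale br) (ker_killing scale br)"
  shows "\<exists>n. (ad br x ^^ n) v = 0"
proof (rule locally_nilpotent_if_traces_0[OF closed endo_ad])
  fix f D
  assume f: "\<And>a b. f (a + b) = f a + f b" and D: "endo D"
    and Df: "\<And>a v. gev (ad br x) a v \<Longrightarrow> D v = of_rat (f a) *s v"
  have der: "D (br u v) = br (D u) v + br u (D v)" for u v
    by (rule diagonal_derivation[OF closed D _ Df]) (auto simp: f of_rat_add)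
  \<comment> \<open>\<open>D\<close> stays the operator built from the original \<open>x\<close>
    while the induction runs through the expansion of \<open>x\<close> into brackets.\<close>
  show "trace_on scale UNIV (ad br x \<circ> D) = 0"
    using x unfolding brk_def
  proof (induction rule: span_induct_alt)
    case base
    have "ad br 0 \<circ> D = (\<lambda>v. 0 *s D v)" by (simp add: ad_def br_simps fun_eq_iff)
    then show ?case using trace_scale[OF D, of 0] by simp
  next
    case (step c y z)
    then have y: "trace_on scale UNIV (ad br y \<circ> D) = 0"
      using trace_ad_br_derivation[OF D der] by (auto simp: ker_killing_def)
    have E: "endo (ad br w \<circ> D)" for w using D endo_ad by (rule endo_comp)
    have "ad br (c *s y + z) \<circ> D = (\<lambda>v. c *s (ad br y \<circ> D) v + (ad br z \<circ> D) v)"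
      by (simp add: ad_scale_add fun_eq_iff)
    with step.IH y show ?case
      by (simp add: trace_add trace_scale endo_scaled E del: comp_apply)
  qed
qed

subsection \<open>Ideals and the radical\<close>

lemma br_span_mem:
  assumes W: "subspace W" and gen: "\<And>x y. x \<in> S \<Longrightarrow> y \<in> T \<Longrightarrow> br x y \<in> W"
    and x: "x \<in> span S" and y: "y \<in> span T"
  shows "br x y \<in> W"
proof -
  have "span T \<subseteq> {y. br u y \<in> W}" if "u \<in> S" for u
    by (rule span_minimal[OF _ subspace_vimage_endo[OF endo_br(1) W]]) (use gen that in blast)
  with y have "S \<subseteq> {x. br x y \<in> W}" by blast
  then have "span S \<subseteq> {x. br x y \<in> W}"
    by (rule span_minimal[OF _ subspace_vimage_endo[OF endo_br(2) W]])
  with x show ?thesis by blast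
qed

lemma brk_subset:
  assumes "subspace W" "\<And>x y. x \<in> X \<Longrightarrow> y \<in> Y \<Longrightarrow> br x y \<in> W"
  shows "brk scale br X Y \<subseteq> W"
  unfolding brk_def using assms by (intro span_minimal) auto

lemma br_mem_brk: "x \<in> X \<Longrightarrow> y \<in> Y \<Longrightarrow> br x y \<in> brk scale br X Y"
  unfolding brk_def by (intro span_base) blast

lemma subspace_brk: "subspace (brk scale br X Y)"
  by (simp add: brk_def)

lemma lideal_subspace: "lideal scale br I \<Longrightarrow> subspace I"
  by (simp add: lideal_def)

lemma lideal_brL: "lideal scale br I \<Longrightarrow> x \<in> I \<Longrightarrow> br x y \<in> I"
  and lideal_brR: "lideal scale br I \<Longrightarrow> x \<in> I \<Longrightarrow> br y x \<in> I"
  by (simp_all add: lideal_def)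

text \<open>Right multiplication uses the derivation rule, left multiplication the Leibniz identity
  itself.\<close>

lemma lideal_brk:
  assumes I: "lideal scale br I"
  shows "lideal scale br (brk scale br I I)"
proof -
  let ?B = "brk scale br I I"
  have "br x y \<in> ?B \<and> br y x \<in> ?B" if "x \<in> ?B" for x y
  proof -
    have x: "x \<in> span {br u v |u v. u \<in> I \<and> v \<in> I}" using that by (simp add: brk_def)
    have y: "y \<in> span UNIV" by simp
    have "br x y \<in> ?B"
    proof (rule br_span_mem[OF subspace_brk _ x y])
      fix x y assume "x \<in> {br u v |u v. u \<in> I \<and> v \<in> I}"
      then obtain u v where uv: "u \<in> I" "v \<in> I" "x = br u v" by blast
      show "br x y \<in> ?B"
        unfolding uv(3) br_derivation[of u v y]
        by (intro subspace_add[OF subspace_brk] br_mem_brk lideal_brL[OF I] uv)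
    qed
    moreover have "br y x \<in> ?B"
    proof (rule br_span_mem[OF subspace_brk _ y x])
      fix y x assume "x \<in> {br u v |u v. u \<in> I \<and> v \<in> I}"
      then obtain u v where uv: "u \<in> I" "v \<in> I" "x = br u v" by blast
      show "br y x \<in> ?B"
        unfolding uv(3) br_br[of y u v]
        by (intro subspace_diff[OF subspace_brk] br_mem_brk lideal_brR[OF I] uv)
    qed
    ultimately show ?thesis ..
  qed
  then show ?thesis by (simp add: lideal_def subspace_brk)
qed

section \<open>Derived series and solvable ideals\<close>

lemma lideal_derived: "lideal scale br I \<Longrightarrow> lideal scale br (derived scale br I n)"
  by (induction n) (auto intro: lideal_brk)

lemma zero_mem_derived: "lideal scale br I \<Longrightarrow> 0 \<in> derived scale br I n"
  using lideal_derived lideal_subspace subspace_0 by blast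

lemma derived_subset: "lideal scale br I \<Longrightarrow> derived scale br I n \<subseteq> I"
proof (induction n)
  case (Suc n)
  show ?case unfolding derived.simps
    by (rule brk_subset[OF lideal_subspace[OF Suc.prems]])
      (use Suc lideal_brL[OF Suc.prems] in blast)
qed simp

lemma derived_derived: "derived scale br (derived scale br I m) n = derived scale br I (m + n)"
  by (induction n) simp_all

lemma derived_mono: "I \<subseteq> J \<Longrightarrow> derived scale br I n \<subseteq> derived scale br J n"
proof (induction n)
  case (Suc n)
  then show ?case by (auto intro!: brk_subset[OF subspace_brk] br_mem_brk)
qed simp

lemma solvable_setI:
  assumes I: "lideal scale br I" and "derived scale br I n \<subseteq> {0}"
  shows "solvable_set scale br I"
proof -
  \<comment> \<open>One further term, since \<open>solvable_set\<close> asks for a positive index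
    and \<open>n\<close> may be 0.\<close>
  have "derived scale br I (Suc n) \<subseteq> {0}"
    unfolding derived.simps
    by (rule brk_subset) (use assms(2) in \<open>auto simp: br_simps\<close>)
  then show ?thesis
    unfolding solvable_set_def using zero_mem_derived[OF I, of "Suc n"]
    by (intro exI[of _ "Suc n"]) auto
qed

lemma lideal_sums:
  assumes I: "lideal scale br I" and J: "lideal scale br J"
  shows "lideal scale br {x + y |x y. x \<in> I \<and> y \<in> J}"
  unfolding lideal_def
proof (intro conjI ballI allI)
  show "subspace {x + y |x y. x \<in> I \<and> y \<in> J}"
    by (rule subspace_sums[OF lideal_subspace[OF I] lideal_subspace[OF J]])
  fix a z assume "a \<in> {x + y |x y. x \<in> I \<and> y \<in> J}"
  then obtain x y where xy: "a = x + y" "x \<in> I" "y \<in> J" by blast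
  show "br a z \<in> {x + y |x y. x \<in> I \<and> y \<in> J}"
    using lideal_brL[OF I xy(2)] lideal_brL[OF J xy(3)] unfolding xy(1) br_simps by blast
  show "br z a \<in> {x + y |x y. x \<in> I \<and> y \<in> J}"
    using lideal_brR[OF I xy(2)] lideal_brR[OF J xy(3)] unfolding xy(1) br_simps by blast
qed

lemma solvable_sums:
  assumes I: "lideal scale br I" "solvable_set scale br I"
    and J: "lideal scale br J" "solvable_set scale br J"
  shows "solvable_set scale br {x + y |x y. x \<in> I \<and> y \<in> J}"
proof -
  let ?S = "{x + y |x y. x \<in> I \<and> y \<in> J}"
  let ?D = "\<lambda>n. {x + y |x y. x \<in> derived scale br I n \<and> y \<in> J}"
  obtain m k where mk: "derived scale br I m = {0}" "derived scale br J k = {0}"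
    using I J by (auto simp: solvable_set_def)
  \<comment> \<open>Modulo \<open>J\<close> the sum has the derived series of \<open>I\<close>.
    After \<open>m\<close> terms it lies in \<open>J\<close>, and \<open>k\<close> more terms kill
    it.\<close>
  have "derived scale br ?S n \<subseteq> ?D n" for n
  proof (induction n)
    case (Suc n)
    show ?case
      unfolding derived.simps(2)[of _ _ ?S]
    proof (rule brk_subset)
      show "subspace (?D (Suc n))"
        by (rule subspace_sums[OF lideal_subspace[OF lideal_derived[OF I(1)]] lideal_subspace[OF J(1)]])
      fix a b assume "a \<in> derived scale br ?S n" "b \<in> derived scale br ?S n"
      with Suc obtain x y u v where *: "a = x + y" "b = u + v" "y \<in> J" "v \<in> J"
        and xu: "x \<in> derived scale br I n" "u \<in> derived scale br I n"
        by blast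
      have "br a b = br x u + (br x v + br y u + br y v)"
        by (simp add: * br_simps)
      moreover have "br x u \<in> derived scale br I (Suc n)"
        using xu by (simp add: br_mem_brk)
      moreover have "br x v + br y u + br y v \<in> J"
        by (intro subspace_add[OF lideal_subspace[OF J(1)]] lideal_brL[OF J(1)] lideal_brR[OF J(1)] *)
      ultimately show "br a b \<in> ?D (Suc n)" by blast
    qed
  qed simp
  from this[of m] have "derived scale br ?S m \<subseteq> J"
    unfolding mk by auto
  then have "derived scale br ?S (m + k) \<subseteq> {0}"
    using derived_mono[of "derived scale br ?S m" J k] by (simp add: derived_derived mk(2))
  then show ?thesis
    by (rule solvable_setI[OF lideal_sums[OF I(1) J(1)]])
qed

lemma Rad_eqI:
  assumes "lideal scale br R" "solvable_set scale br R"
    and "\<And>I. lideal scale br I \<Longrightarrow> solvable_set scale br I \<Longrightarrow> I \<subseteq> R"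
  shows "Rad scale br = R"
  unfolding Rad_def using assms by (intro the_equality) auto

text \<open>This justifies the \<open>THE\<close> in \<open>Rad\<close>: adding a solvable ideal to
  a maximal one gives nothing new.\<close>

lemma solvable_subset_Rad:
  assumes I: "lideal scale br I" "solvable_set scale br I"
  shows "I \<subseteq> Rad scale br"
proof -
  let ?P = "\<lambda>J. lideal scale br J \<and> solvable_set scale br J"
  obtain R where R: "?P R" and max: "\<And>J. ?P J \<Longrightarrow> R \<subseteq> J \<Longrightarrow> J = R"
    by (rule maximal_subspace[of ?P I]) (use I lideal_subspace in blast)+
  have le: "J \<subseteq> R" if J: "?P J" for J
  proof -
    let ?S = "{x + y |x y. x \<in> R \<and> y \<in> J}"
    have 0: "0 \<in> R" "0 \<in> J" using R J lideal_subspace subspace_0 by blast+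
    have "R \<subseteq> ?S" "J \<subseteq> ?S" using 0 by force+
    moreover have "?P ?S" using R J lideal_sums solvable_sums by blast
    ultimately show ?thesis using max by blast
  qed
  with R have "Rad scale br = R" by (intro Rad_eqI) auto
  with le I show ?thesis by simp
qed

lemma br_Ess:
  assumes "e \<in> Ess scale br"
  shows "br v e = 0"
proof -
  have "Ess scale br \<subseteq> {x. br v x \<in> {0}}"
    unfolding Ess_def
    by (rule span_minimal[OF _ subspace_vimage_endo[OF endo_br(1) subspace_single_0]]) auto
  with assms show ?thesis by auto
qed

lemma subspace_Ess: "subspace (Ess scale br)"
  by (simp add: Ess_def)

lemma lideal_Ess: "lideal scale br (Ess scale br)"
  unfolding lideal_def
proof (intro conjI ballI allI subspace_Ess)
  fix e y assume e: "e \<in> Ess scale br"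
  then show "br y e \<in> Ess scale br" using subspace_0[OF subspace_Ess] by (simp add: br_Ess)
  have sq: "br z z \<in> Ess scale br" for z unfolding Ess_def by (rule span_base) blast
  have y: "y \<in> span UNIV" by simp
  show "br e y \<in> Ess scale br"
  proof (rule br_span_mem[OF subspace_Ess _ e[unfolded Ess_def] y])
    fix x y assume "x \<in> {br x x |x. True}"
    then obtain u where x: "x = br u u" by blast
    \<comment> \<open>Polarisation: \<open>[[u,u],y]\<close> is the sum of the two mixed brackets of
      \<open>u\<close> and \<open>[u,y]\<close>.\<close>
    have "br x y = br (u + br u y) (u + br u y) - br u u - br (br u y) (br u y)"
      unfolding x br_derivation[of u u y] by (simp add: br_simps)
    then show "br x y \<in> Ess scale br"
      using sq subspace_diff[OF subspace_Ess] by metis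
  qed
qed

lemma solvable_Ess: "solvable_set scale br (Ess scale br)"
proof (rule solvable_setI[OF lideal_Ess])
  show "derived scale br (Ess scale br) 1 \<subseteq> {0}"
    by (simp, rule brk_subset) (auto simp: br_Ess)
qed

lemma Ess_subset_ker_killing: "Ess scale br \<subseteq> ker_killing scale br"
  by (auto simp: ker_killing_def intro: ad_eq_0_killing br_Ess)

lemma abelian_mod_Ess_subset_ker_killing:
  assumes killing: "killing_leibniz scale br" and A: "lideal scale br A"
    and AA: "brk scale br A A \<subseteq> Ess scale br"
  shows "A \<subseteq> ker_killing scale br"
proof
  fix a assume a: "a \<in> A"
  let ?E = "Ess scale br" and ?t = "trace_on scale"
  have "?t UNIV (ad br a \<circ> ad br y) = 0" for y
  proof -
    let ?f = "ad br a \<circ> ad br y"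
    have f: "endo ?f" by (rule endo_o[OF endo_ad endo_ad])
    note sA = lideal_subspace[OF A]
    \<comment> \<open>The intersection links the two traces: \<open>?f\<close> maps both
      \<open>A\<close> and \<open>Ess\<close> into it.\<close>
    have sAE: "subspace (A \<inter> ?E)" by (rule subspace_inter[OF sA subspace_Ess])
    have fA: "?f v \<in> A" for v by (simp add: ad_def lideal_brR[OF A a])
    have "?t UNIV ?f = ?t A ?f"
      by (rule trace_on_image_subset[OF f subspace_UNIV sA]) (use fA in auto)
    also have "\<dots> = ?t (A \<inter> ?E) ?f"
    proof (rule trace_on_image_subset[OF f sA sAE])
      have "?f v \<in> ?E" if "v \<in> A" for v
        using AA br_mem_brk[OF lideal_brL[OF A that] a] by (auto simp: ad_def)
      with fA show "?f ` A \<subseteq> A \<inter> ?E" by blast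
    qed blast
    also have "\<dots> = ?t ?E ?f"
    proof (rule trace_on_image_subset[OF f subspace_Ess sAE, symmetric])
      have "?f v \<in> ?E" if "v \<in> ?E" for v
        using that by (simp add: ad_def lideal_brL[OF lideal_Ess])
      with fA show "?f ` ?E \<subseteq> A \<inter> ?E" by blast
    qed blast
    also have "\<dots> = 0" using killing by (simp add: killing_leibniz_def)
    finally show ?thesis .
  qed
  then show "a \<in> ker_killing scale br" by (simp add: ker_killing_def killing_def)
qed

subsection \<open>Engel's theorem\<close>

text \<open>The operators \<open>R\<^sub>k\<close> with \<open>k \<in> K\<close> have a common nonzero null vector on every nonzero
  subquotient, which passes from \<open>K\<close> to larger subalgebras without tracking any nilpotency index.\<close>

definition engel :: "'v set \<Rightarrow> bool" where
  "engel K \<longleftrightarrow> (\<forall>U W. subspace U \<and> subspace W \<and> W \<subset> U \<and>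
      (\<forall>u\<in>U. \<forall>k\<in>K. br u k \<in> U) \<and> (\<forall>w\<in>W. \<forall>k\<in>K. br w k \<in> W) \<longrightarrow>
      (\<exists>v\<in>U - W. \<forall>k\<in>K. br v k \<in> W))"

lemma engelD:
  assumes "engel K" "subspace U" "subspace W" "W \<subset> U"
    "\<And>u k. u \<in> U \<Longrightarrow> k \<in> K \<Longrightarrow> br u k \<in> U" "\<And>w k. w \<in> W \<Longrightarrow> k \<in> K \<Longrightarrow> br w k \<in> W"
  obtains v where "v \<in> U" "v \<notin> W" "\<And>k. k \<in> K \<Longrightarrow> br v k \<in> W"
  using assms unfolding engel_def by (metis DiffE)

text \<open>Vectors killed by \<open>K\<close> modulo \<open>W\<close> are stable under
  \<open>ad br z\<close>. By nilpotency, some iterate outside \<open>W\<close> is sent into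
  \<open>W\<close> by \<open>z\<close> as well.\<close>

lemma engel_insert:
  assumes K: "engel K" and zK: "\<And>k. k \<in> K \<Longrightarrow> br z k \<in> K"
    and nil: "\<And>v. \<exists>n. (ad br z ^^ n) v = 0"
  shows "engel (span (insert z K))"
  unfolding engel_def
proof (intro allI impI, elim conjE)
  fix U W assume U: "subspace U" and W: "subspace W" and "W \<subset> U"
    and invU: "\<forall>u\<in>U. \<forall>k\<in>span (insert z K). br u k \<in> U"
    and invW: "\<forall>w\<in>W. \<forall>k\<in>span (insert z K). br w k \<in> W"
  have K': "k \<in> span (insert z K)" if "k \<in> K" for k using that by (simp add: span_base)
  have z': "z \<in> span (insert z K)" by (simp add: span_base)
  obtain v where v: "v \<in> U" "v \<notin> W" "\<And>k. k \<in> K \<Longrightarrow> br v k \<in> W"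
    by (rule engelD[OF K U W \<open>W \<subset> U\<close>]) (use invU invW K' in blast)+
  let ?u = "\<lambda>n. (ad br z ^^ n) v"
  have u: "?u n \<in> U \<and> (\<forall>k\<in>K. br (?u n) k \<in> W)" for n
  proof (induction n)
    case 0
    with v show ?case by simp
  next
    case (Suc n)
    have "br (br (?u n) z) k \<in> W" if k: "k \<in> K" for k
    proof -
      have "br (br (?u n) k) z \<in> W" "br (?u n) (br z k) \<in> W"
        using Suc k zK invW z' by blast+
      then show ?thesis unfolding br_derivation[of "?u n" z k] using W by (blast intro: subspace_add)
    qed
    moreover have "br (?u n) z \<in> U" using Suc invU z' by blast
    ultimately show ?case by (simp add: ad_def)
  qed
  obtain n where "?u n = 0" using nil by blast
  then have ex: "\<exists>n. ?u n \<in> W" using subspace_0[OF W] by (intro exI[of _ n]) simp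
  \<comment> \<open>The first iterate inside \<open>W\<close>; its predecessor is the required
    vector.\<close>
  define m where "m = (LEAST n. ?u n \<in> W)"
  have m: "?u m \<in> W" unfolding m_def using ex by (rule LeastI_ex)
  with v have "m \<noteq> 0" by (intro notI) simp
  then obtain j where j: "m = Suc j" by (cases m) auto
  then have uj: "?u j \<notin> W" using not_less_Least[of j "\<lambda>n. ?u n \<in> W"] by (simp add: m_def)
  have "br (?u j) z \<in> W" using m by (simp add: j ad_def)
  with u have "insert z K \<subseteq> {k. br (?u j) k \<in> W}" by blast
  then have "span (insert z K) \<subseteq> {k. br (?u j) k \<in> W}"
    by (rule span_minimal[OF _ subspace_vimage_endo[OF endo_br(1) W]])
  with u uj show "\<exists>v\<in>U - W. \<forall>k\<in>span (insert z K). br v k \<in> W" by blast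
qed

text \<open>A maximal subalgebra with the Engel property can be enlarged by one normalising element. It has to
  contain the right annihilator \<open>Z\<close>, as \<open>[k,z]\<close> equals \<open>- [z,k]\<close> only modulo \<open>Z\<close>.\<close>

lemma engel_ideal:
  assumes N: "lideal scale br N" and nil: "\<And>x v. x \<in> N \<Longrightarrow> \<exists>n. (ad br x ^^ n) v = 0"
  shows "engel N"
proof -
  define Z where "Z = {x \<in> N. \<forall>v. br v x = 0}"
  define P where "P K \<longleftrightarrow> subspace K \<and> Z \<subseteq> K \<and> K \<subseteq> N \<and> (\<forall>x\<in>K. \<forall>y\<in>K. br x y \<in> K) \<and> engel K" for K
  note sN = lideal_subspace[OF N]
  have "P Z"
  proof -
    have "subspace Z"
      using sN by (auto simp: Z_def subspace_def br_simps)
    moreover have "engel Z"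
      unfolding engel_def
    proof (intro allI impI, elim conjE)
      fix U W assume W: "subspace W" and "W \<subset> U"
      then obtain v where "v \<in> U - W" by blast
      then show "\<exists>v\<in>U - W. \<forall>k\<in>Z. br v k \<in> W"
        using subspace_0[OF W] by (intro bexI[of _ v]) (auto simp: Z_def)
    qed
    moreover have "br x y \<in> Z" if "x \<in> Z" "y \<in> Z" for x y
      using that subspace_0[OF sN] by (auto simp: Z_def br_simps)
    ultimately show ?thesis by (auto simp: P_def Z_def)
  qed
  then obtain K where K: "P K" and max: "\<And>K'. P K' \<Longrightarrow> K \<subseteq> K' \<Longrightarrow> K' = K"
    by (rule maximal_subspace[of P Z]) (auto simp: P_def)
  from K have sK: "subspace K" and ZK: "Z \<subseteq> K" and KN: "K \<subseteq> N"
    and KK: "\<And>x y. x \<in> K \<Longrightarrow> y \<in> K \<Longrightarrow> br x y \<in> K" and eK: "engel K"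
    by (auto simp: P_def)
  have "K = N"
  proof (rule ccontr)
    assume "K \<noteq> N"
    with KN have "K \<subset> N" by blast
    \<comment> \<open>The Engel property of \<open>K\<close> on the subquotient of \<open>N\<close>
      by \<open>K\<close> yields the normalising element.\<close>
    then obtain z where z: "z \<in> N" "z \<notin> K" "\<And>k. k \<in> K \<Longrightarrow> br z k \<in> K"
      by (rule engelD[OF eK sN sK]) (use lideal_brL[OF N] KK in blast)+
    let ?K = "span (insert z K)"
    have KK': "K \<subseteq> ?K" "z \<in> ?K" using span_superset[of "insert z K"] by auto
    have gen: "br x y \<in> K" if "x \<in> insert z K" "y \<in> insert z K" for x y
    proof -
      \<comment> \<open>Squares annihilate from the right, so this one lies in
        \<open>Z\<close>.\<close>
      have zz: "br z z \<in> K"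
        using ZK lideal_brL[OF N z(1)] by (auto simp: Z_def)
      have kz: "br k z \<in> K" if k: "k \<in> K" for k
      proof -
        have "br k z + br z k \<in> Z"
          using sN k KN by (auto simp: Z_def br_simps br_br intro!: subspace_add lideal_brL[OF N] z(1))
        with ZK have "br k z + br z k \<in> K" by blast
        from subspace_diff[OF sK this z(3)[OF k]] show ?thesis by simp
      qed
      from that zz kz z(3) KK show ?thesis by blast
    qed
    have "br x y \<in> ?K" if "x \<in> ?K" "y \<in> ?K" for x y
      by (rule br_span_mem[OF subspace_span _ that]) (use gen KK' in blast)
    moreover have "?K \<subseteq> N" using z(1) KN by (intro span_minimal sN) blast
    moreover have "engel ?K" by (rule engel_insert[OF eK z(3) nil[OF z(1)]])
    ultimately have "P ?K" using ZK KK'(1) by (auto simp: P_def)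
    from max[OF this KK'(1)] KK'(2) z(2) show False by blast
  qed
  with eK show ?thesis by simp
qed

text \<open>Climb from \<open>{0}\<close> to the whole space through subspaces stable under
  \<open>N\<close>. Passing to the common null vectors modulo \<open>W\<close> costs one term of the
  derived series.\<close>

lemma engel_solvable:
  assumes N: "lideal scale br N" and engel: "engel N"
  shows "solvable_set scale br N"
proof -
  let ?D = "derived scale br N"
  \<comment> \<open>The number \<open>m\<close> bounds, uniformly in \<open>i\<close>, how many more
    terms vanish a derived term already inside \<open>W\<close>.\<close>
  define Q where "Q W \<longleftrightarrow> subspace W \<and> (\<forall>w\<in>W. \<forall>k\<in>N. br w k \<in> W) \<and>
    (\<exists>m. \<forall>i. ?D i \<subseteq> W \<longrightarrow> ?D (i + m) \<subseteq> {0})" for W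
  have "Q {0}" unfolding Q_def by (intro conjI exI[of _ 0]) (auto simp: br_simps)
  then obtain W where W: "Q W" and max: "\<And>W'. Q W' \<Longrightarrow> W \<subseteq> W' \<Longrightarrow> W' = W"
    by (rule maximal_subspace[of Q "{0}"]) (auto simp: Q_def)
  from W have sW: "subspace W" and inv: "\<And>w k. w \<in> W \<Longrightarrow> k \<in> N \<Longrightarrow> br w k \<in> W"
    by (auto simp: Q_def)
  from W obtain m where m: "\<And>i. ?D i \<subseteq> W \<Longrightarrow> ?D (i + m) \<subseteq> {0}" by (auto simp: Q_def)
  have "W = UNIV"
  proof (rule ccontr)
    assume "W \<noteq> UNIV"
    then have "W \<subset> UNIV" by blast
    then obtain v where v: "v \<notin> W" "\<And>k. k \<in> N \<Longrightarrow> br v k \<in> W"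
      by (rule engelD[OF engel subspace_UNIV sW]) (use inv in blast)+
    define W' where "W' = {v. \<forall>k\<in>N. br v k \<in> W}"
    have WW': "W \<subseteq> W'" using inv by (auto simp: W'_def)
    have "subspace W'"
      using sW by (auto simp: W'_def subspace_def br_simps)
    moreover have "\<forall>w\<in>W'. \<forall>k\<in>N. br w k \<in> W'" using WW' by (auto simp: W'_def)
    moreover have "?D (i + Suc m) \<subseteq> {0}" if "?D i \<subseteq> W'" for i
    proof -
      have "?D (Suc i) \<subseteq> W"
        unfolding derived.simps
        by (rule brk_subset[OF sW]) (use that derived_subset[OF N] in \<open>auto simp: W'_def\<close>)
      from m[OF this] show ?thesis by simp
    qed
    ultimately have "Q W'" unfolding Q_def by blast
    from max[OF this WW'] v show False by (auto simp: W'_def)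
  qed
  \<comment> \<open>For \<open>W\<close> the whole space the bound applies at \<open>i = 0\<close>,
    that is, to \<open>N\<close> itself.\<close>
  with m[of 0] show ?thesis using solvable_setI[OF N] by simp
qed

section \<open>Solvability of the kernel and the two implications\<close>

lemma ker_killing_solvable:
  assumes "alg_closed TYPE('k)"
  shows "solvable_set scale br (ker_killing scale br)"
proof -
  let ?N = "ker_killing scale br"
  have I: "lideal scale br (brk scale br ?N ?N)" by (rule lideal_brk[OF lideal_ker_killing])
  have "solvable_set scale br (brk scale br ?N ?N)"
    by (rule engel_solvable[OF I engel_ideal[OF I ad_locally_nilpotent[OF assms]]])
  then obtain m where "derived scale br (derived scale br ?N 1) m = {0}"
    by (auto simp: solvable_set_def)
  then show ?thesis
    unfolding derived_derived by (intro solvable_setI[OF lideal_ker_killing, of "1 + m"]) simp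
qed

lemma solvable_subset_Ess:
  assumes killing: "killing_leibniz scale br" and ker: "ker_killing scale br = Ess scale br"
    and I: "lideal scale br I" "solvable_set scale br I"
  shows "I \<subseteq> Ess scale br"
proof -
  obtain m where m: "derived scale br I m = {0}" using I(2) by (auto simp: solvable_set_def)
  \<comment> \<open>Induction up the derived series from its zero term. Truncated subtraction keeps
    the index at 0 once \<open>I\<close> is reached.\<close>
  have "derived scale br I (m - n) \<subseteq> Ess scale br" for n
  proof (induction n)
    case 0
    show ?case using m subspace_0[OF subspace_Ess] by simp
  next
    case (Suc n)
    show ?case
    proof (cases "n < m")
      case True
      then have "brk scale br (derived scale br I (m - Suc n)) (derived scale br I (m - Suc n))
          = derived scale br I (m - n)"
        by (metis Suc_diff_Suc derived.simps(2))
      \<comment> \<open>The brackets of this term form the next one, which lies in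
        \<open>Ess\<close> by induction, so the term is abelian modulo \<open>Ess\<close>.\<close>
      with Suc have "derived scale br I (m - Suc n) \<subseteq> ker_killing scale br"
        by (intro abelian_mod_Ess_subset_ker_killing[OF killing lideal_derived[OF I(1)]]) simp
      with ker show ?thesis by simp
    next
      case False
      with Suc show ?thesis by simp
    qed
  qed
  from this[of m] show ?thesis by simp
qed

theorem ker_killing_eq_Ess_iff_semisimple:
  assumes closed: "alg_closed TYPE('k)" and killing: "killing_leibniz scale br"
  shows "ker_killing scale br = Ess scale br \<longleftrightarrow> semisimple scale br"
proof
  assume "ker_killing scale br = Ess scale br"
  then show "semisimple scale br"
    unfolding semisimple_def
    by (intro Rad_eqI lideal_Ess solvable_Ess solvable_subset_Ess[OF killing])
next
  assume "semisimple scale br"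
  then have "ker_killing scale br \<subseteq> Ess scale br"
    unfolding semisimple_def
    using solvable_subset_Rad[OF lideal_ker_killing ker_killing_solvable[OF closed]] by simp
  with Ess_subset_ker_killing show "ker_killing scale br = Ess scale br" by blast
qed

end

theorem theorem5p2:
  fixes scale :: "'k::field_char_0 \<Rightarrow> 'a::ab_group_add \<Rightarrow> 'a"
    and Basis :: "'a set"
    and br :: "'a \<Rightarrow> 'a \<Rightarrow> 'a"
  assumes "alg_closed TYPE('k)"
    and "finite_dimensional_vector_space scale Basis"
    and "leibniz_algebra scale br"
    and "killing_leibniz scale br"
  shows "ker_killing scale br = Ess scale br \<longleftrightarrow> semisimple scale br"
proof -
  interpret leibniz scale Basis br
    using assms(2,3) by (intro leibniz.intro char_0_space.intro leibniz_axioms.intro)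
  show ?thesis
    using assms(1,4) by (rule ker_killing_eq_Ess_iff_semisimple)
qed

end
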